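(* Let $n\ge 2$, let $\alpha_1,\dots,\alpha_n>0$ be pairwise distinct, let $c<0$, let $X_1,\dots,X_n$ be independent with $X_i\sim \mathrm{Exp}(\alpha_i)$, and set $k_i=-c\ln\alpha_i$, $\lambda=-c$ and $Y_i=c\ln X_i$. Then $Y_i\sim \mathrm{ExtremeValue}(k_i,\lambda)$ for each $i$, and the Mixed Hypoexponential Extreme Value distribution $Z\sim MHE(k_1,\dots,k_n,\lambda)$, i.e. the mixed T-G distribution generated from the hypoexponential distribution with parameters $(\alpha_1,\dots,\alpha_n)$ and the transformation $x\mapsto c\ln x$, has PDF $$f_Z(t)=\sum_{i=1}^n\frac{1}{PE_i}f_{Y_i}(t),\qquad PE_i=\prod_{j=1,\,j\ne i}^{n}\left(1-e^{\frac{k_i-k_j}{\lambda}}\right).$$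
   Context: $\mathrm{Exp}(\alpha)$ has density $\alpha e^{-\alpha t}$ for $t>0$. The hypoexponential distribution with pairwise distinct parameters $\alpha_1,\dots,\alpha_n>0$ is the law of $T=\sum_{i=1}^nX_i$ with $X_i\sim\mathrm{Exp}(\alpha_i)$ independent; its density is $f_{T}(t)=\sum_{i=1}^n\frac{f_{X_i}(t)}{P_i}$, $t>0$, where $P_i=\prod_{j\ne i}\left(1-\frac{\alpha_i}{\alpha_j}\right)$ (known fact). If a distribution $T$ has density $\sum_iA_if_{X_i}$ with $A_i\in\mathbb{R}$, $\sum_iA_i=1$, and $g$ is a one-to-one function, the mixed T-G distribution generated from $T$ and $g$ is the distribution with density $\sum_iA_if_{g(X_i)}$. $\mathrm{ExtremeValue}(k,\lambda)$ with location $k\in\mathbb{R}$ and scale $\lambda>0$ has density $\frac1\lambda\exp\left(-e^{\frac{-t+k}{\lambda}}+\frac{-t+k}{\lambda}\right)$, $t\in\mathbb{R}$. *)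

theory Defs
  imports "HOL-Probability.Probability"
begin

definition has_pdf :: "real measure \<Rightarrow> (real \<Rightarrow> real) \<Rightarrow> bool" where
  "has_pdf D f \<longleftrightarrow> prob_space D \<and> f \<in> borel_measurable borel \<and> (\<forall>t. 0 \<le> f t)
     \<and> D = density lborel (\<lambda>t. ennreal (f t))"

definition extreme_value_density :: "real \<Rightarrow> real \<Rightarrow> real \<Rightarrow> real" where
  "extreme_value_density k l t = 1 / l * exp (- exp ((- t + k) / l) + (- t + k) / l)"

text \<open>
  \<^term>\<open>mixed_TG I \<mu> T S g D\<close> says that \<^term>\<open>D\<close> is a mixed T-G distribution generated from the
  distribution \<^term>\<open>T\<close> and the transformation \<^term>\<open>g\<close>, where \<^term>\<open>\<mu> i\<close> is the law of the
  component variable \<open>X\<^sub>i\<close>. The set \<^term>\<open>S\<close> is the domain on which \<^term>\<open>g\<close> is one-to-one; it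
  carries all the components. The weights \<open>A\<^sub>i\<close> may be negative. Since densities are only
  determined almost everywhere, some choice of versions is required to exist.
\<close>
definition mixed_TG ::
  "'i set \<Rightarrow> ('i \<Rightarrow> real measure) \<Rightarrow> real measure \<Rightarrow> real set \<Rightarrow> (real \<Rightarrow> real) \<Rightarrow> real measure \<Rightarrow> bool"
where
  "mixed_TG I \<mu> T S g D \<longleftrightarrow>
     S \<in> sets borel \<and> g \<in> borel_measurable borel \<and> inj_on g S \<and>
     (\<forall>i\<in>I. AE x in \<mu> i. x \<in> S) \<and>
     (\<exists>(A :: 'i \<Rightarrow> real) fX fgX.
        (\<Sum>i\<in>I. A i) = 1 \<and>
        (\<forall>i\<in>I. has_pdf (\<mu> i) (fX i)) \<and>
        has_pdf T (\<lambda>t. \<Sum>i\<in>I. A i * fX i t) \<and>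
        (\<forall>i\<in>I. has_pdf (distr (\<mu> i) borel g) (fgX i)) \<and>
        has_pdf D (\<lambda>t. \<Sum>i\<in>I. A i * fgX i t))"

definition PE :: "nat \<Rightarrow> (nat \<Rightarrow> real) \<Rightarrow> real \<Rightarrow> nat \<Rightarrow> real" where
  "PE n k l i = (\<Prod>j\<in>{1..n} - {i}. 1 - exp ((k i - k j) / l))"

end

theory Submission
  imports Defs
begin

text \<open>
  The convolution of \<open>\<Sum>\<^sub>i w\<^sub>i \<alpha>\<^sub>i e\<^sup>-\<^sup>\<alpha>\<^sup>i\<^sup>x\<close> with an exponential density is again a combination of
  exponentials; the coefficient of the new exponential is evaluated by Lagrange interpolation of
  the constant \<open>1\<close>, and interpolation at \<open>0\<close> shows that the weights sum to \<open>1\<close>. Exponentials with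
  distinct rates are linearly independent, so the weights of a mixture are forced by its density,
  and the mixed distribution is the corresponding combination of the densities of \<open>c ln X\<^sub>i\<close>.
  That combination is nonnegative because it is the density of the sum, transported by \<open>c ln x\<close>.
\<close>

section \<open>Densities\<close>

lemma has_pdf_AE_unique:
  assumes "has_pdf D f" "has_pdf D g"
  shows "AE x in lborel. f x = g x"
proof -
  have "AE x in lborel. ennreal (f x) = ennreal (g x)"
    using assms by (intro sigma_finite_measure.density_unique[OF sigma_finite_lborel])
      (auto simp: has_pdf_def)
  then show ?thesis
    using assms by (auto simp: has_pdf_def)
qed

text \<open>Bridge from \<open>distributed\<close> to \<open>has_pdf\<close>: the targets
  \<open>lborel\<close> and \<open>borel\<close> have the same sets, so both push-forwards coincide.
  \<open>has_pdf\<close> fixes a real version that is nonnegative everywhere, which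
  \<open>ennreal\<close> alone would not reveal.\<close>

lemma (in prob_space) has_pdf_distr:
  assumes "distributed M lborel X (\<lambda>x. ennreal (f x))"
    and "f \<in> borel_measurable borel" and "\<And>x. 0 \<le> f x"
  shows "has_pdf (distr M borel X) f"
proof -
  have "distr M borel X = distr M lborel X"
    by (rule distr_cong) auto
  moreover have "X \<in> borel_measurable M"
    using distributed_measurable[OF assms(1)] by simp
  moreover from this have "prob_space (distr M borel X)"
    by (intro prob_space_distr) simp
  ultimately show ?thesis
    using assms by (simp add: has_pdf_def distributed_distr_eq_density)
qed

section \<open>The hypoexponential density\<close>

text \<open>This is \<open>1 / P_i\<close>, each factor being the reciprocal of
  \<open>1 - \<alpha> i / \<alpha> j\<close>. It is also the value at 0 of the \<open>i\<close>-th
  Lagrange basis polynomial for the nodes \<open>\<alpha> j\<close>. General index sets allow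
  induction by inserting one rate at a time.\<close>

definition hypoexp_weight :: "'i set \<Rightarrow> ('i \<Rightarrow> real) \<Rightarrow> 'i \<Rightarrow> real" where
  "hypoexp_weight I \<alpha> i = (\<Prod>j\<in>I - {i}. \<alpha> j / (\<alpha> j - \<alpha> i))"

definition hypoexp_density :: "'i set \<Rightarrow> ('i \<Rightarrow> real) \<Rightarrow> real \<Rightarrow> real" where
  "hypoexp_density I \<alpha> x = (\<Sum>i\<in>I. hypoexp_weight I \<alpha> i * exponential_density (\<alpha> i) x)"

text \<open>As a function of \<open>x\<close> the sum is a polynomial of degree below
  \<open>card I\<close> that takes the value 1 at the \<open>card I\<close> distinct nodes, so it is
  constant. It is used at \<open>x = 0\<close> for the total weight and at a new rate for the new
  coefficient.\<close>

lemma lagrange_interpolation_one: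
  fixes \<alpha> :: "'i \<Rightarrow> real"
  assumes "finite I" "I \<noteq> {}" "inj_on \<alpha> I"
  shows "(\<Sum>i\<in>I. \<Prod>j\<in>I - {i}. (\<alpha> j - x) / (\<alpha> j - \<alpha> i)) = 1"
proof -
  define p where
    "p = (\<Sum>i\<in>I. \<Prod>j\<in>I - {i}. [:\<alpha> j / (\<alpha> j - \<alpha> i), - 1 / (\<alpha> j - \<alpha> i):])"
  have p: "poly p y = (\<Sum>i\<in>I. \<Prod>j\<in>I - {i}. (\<alpha> j - y) / (\<alpha> j - \<alpha> i))" for y
    by (simp add: p_def poly_sum poly_prod diff_divide_distrib)
  have "poly p (\<alpha> m) = 1" if "m \<in> I" for m
  proof -
    have "(\<Prod>j\<in>I - {i}. (\<alpha> j - \<alpha> m) / (\<alpha> j - \<alpha> i)) = (if i = m then 1 else 0)" if "i \<in> I" for i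
    proof (cases "i = m")
      case True
      have "(\<alpha> j - \<alpha> m) / (\<alpha> j - \<alpha> i) = 1" if "j \<in> I - {i}" for j
        using that True \<open>m \<in> I\<close> \<open>inj_on \<alpha> I\<close> by (auto dest: inj_onD)
      then show ?thesis
        using True by simp
    next
      case False
      \<comment> \<open>The factor with \<open>j = m\<close> is zero.\<close>
      then show ?thesis
        using \<open>m \<in> I\<close> \<open>finite I\<close> by (auto intro!: prod_zero)
    qed
    then have "poly p (\<alpha> m) = (\<Sum>i\<in>I. if i = m then 1 else 0)"
      unfolding p by (intro sum.cong) auto
    then show ?thesis
      using \<open>m \<in> I\<close> \<open>finite I\<close> by simp
  qed
  moreover have "degree p < card I"
  proof -
    have "degree (\<Prod>j\<in>I - {i}. [:\<alpha> j / (\<alpha> j - \<alpha> i), - 1 / (\<alpha> j - \<alpha> i):]) \<le> card I - 1"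
      if "i \<in> I" for i
    proof -
      have "degree (\<Prod>j\<in>I - {i}. [:\<alpha> j / (\<alpha> j - \<alpha> i), - 1 / (\<alpha> j - \<alpha> i):])
          \<le> (\<Sum>j\<in>I - {i}. degree [:\<alpha> j / (\<alpha> j - \<alpha> i), - 1 / (\<alpha> j - \<alpha> i):])"
        using degree_prod_sum_le[of "I - {i}"] \<open>finite I\<close> unfolding o_def by blast
      also have "\<dots> \<le> (\<Sum>j\<in>I - {i}. 1)"
        by (intro sum_mono) auto
      finally show ?thesis
        using that \<open>finite I\<close> by simp
    qed
    then have "degree p \<le> card I - 1"
      unfolding p_def using \<open>finite I\<close> by (intro degree_sum_le) auto
    moreover have "card I > 0"
      using assms by (simp add: card_gt_0_iff)
    ultimately show ?thesis
      by linarith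
  qed
  ultimately have "p = 1"
    using \<open>inj_on \<alpha> I\<close> by (intro poly_eqI_degree[of "\<alpha> ` I"]) (auto simp: card_image)
  then show ?thesis
    using p[of x] by simp
qed

lemma sum_hypoexp_weight:
  assumes "finite I" "I \<noteq> {}" "inj_on \<alpha> I"
  shows "(\<Sum>i\<in>I. hypoexp_weight I \<alpha> i) = 1"
  using lagrange_interpolation_one[OF assms, of 0] by (simp add: hypoexp_weight_def)

lemma hypoexp_weight_insert_old:
  assumes "finite I" "m \<notin> I" "i \<in> I"
  shows "hypoexp_weight (insert m I) \<alpha> i = hypoexp_weight I \<alpha> i * (\<alpha> m / (\<alpha> m - \<alpha> i))"
proof -
  have "insert m I - {i} = insert m (I - {i})"
    using assms by auto
  then show ?thesis
    using assms by (simp add: hypoexp_weight_def)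
qed

text \<open>Convolving the \<open>i\<close>-th exponential density with that of rate
  \<open>\<alpha> m\<close> contributes \<open>\<alpha> i / (\<alpha> i - \<alpha> m)\<close> to the
  new exponential. Splitting each factor of the old weight at \<open>\<alpha> j - \<alpha> m\<close>
  extracts a product \<open>?Q\<close> independent of \<open>i\<close>; what remains sums to 1 by
  interpolation at \<open>\<alpha> m\<close>.\<close>

lemma hypoexp_weight_insert_new:
  assumes "finite I" "I \<noteq> {}" "m \<notin> I" "inj_on \<alpha> (insert m I)" "\<And>i. i \<in> I \<Longrightarrow> \<alpha> i \<noteq> 0"
  shows "hypoexp_weight (insert m I) \<alpha> m =
    (\<Sum>i\<in>I. hypoexp_weight I \<alpha> i * (\<alpha> i / (\<alpha> i - \<alpha> m)))"
proof -
  have ne: "\<alpha> i \<noteq> \<alpha> m" if "i \<in> I" for i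
    using that assms(3,4) by (auto simp: inj_on_def)
  let ?Q = "\<Prod>j\<in>I. \<alpha> j / (\<alpha> j - \<alpha> m)"
  have "hypoexp_weight I \<alpha> i * (\<alpha> i / (\<alpha> i - \<alpha> m)) =
      ?Q * (\<Prod>j\<in>I - {i}. (\<alpha> j - \<alpha> m) / (\<alpha> j - \<alpha> i))" if "i \<in> I" for i
  proof -
    have "?Q = \<alpha> i / (\<alpha> i - \<alpha> m) * (\<Prod>j\<in>I - {i}. \<alpha> j / (\<alpha> j - \<alpha> m))"
      using that \<open>finite I\<close> by (simp add: prod.remove)
    moreover have "hypoexp_weight I \<alpha> i =
        (\<Prod>j\<in>I - {i}. \<alpha> j / (\<alpha> j - \<alpha> m)) * (\<Prod>j\<in>I - {i}. (\<alpha> j - \<alpha> m) / (\<alpha> j - \<alpha> i))"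
      unfolding hypoexp_weight_def prod.distrib[symmetric]
      by (rule prod.cong) (auto dest: ne)
    ultimately show ?thesis
      by simp
  qed
  then have "(\<Sum>i\<in>I. hypoexp_weight I \<alpha> i * (\<alpha> i / (\<alpha> i - \<alpha> m))) =
      ?Q * (\<Sum>i\<in>I. \<Prod>j\<in>I - {i}. (\<alpha> j - \<alpha> m) / (\<alpha> j - \<alpha> i))"
    by (simp add: sum_distrib_left)
  also have "\<dots> = ?Q"
    using assms by (subst lagrange_interpolation_one) auto
  also have "?Q = hypoexp_weight (insert m I) \<alpha> m"
    using assms(3) by (simp add: hypoexp_weight_def)
  finally show ?thesis
    by simp
qed

text \<open>Regrouping by old indices makes each summand a weighted convolution of two exponential
  densities, the shape in which the integral is computed below.\<close>

lemma hypoexp_density_insert: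
  assumes "finite I" "I \<noteq> {}" "m \<notin> I" "inj_on \<alpha> (insert m I)" "\<And>i. i \<in> I \<Longrightarrow> \<alpha> i \<noteq> 0" "0 \<le> x"
  shows "hypoexp_density (insert m I) \<alpha> x =
    (\<Sum>i\<in>I. hypoexp_weight I \<alpha> i * \<alpha> i * \<alpha> m *
      ((exp (- \<alpha> m * x) - exp (- \<alpha> i * x)) / (\<alpha> i - \<alpha> m)))"
proof -
  have ne: "\<alpha> i \<noteq> \<alpha> m" if "i \<in> I" for i
    using that assms(3,4) by (auto simp: inj_on_def)
  have "hypoexp_density (insert m I) \<alpha> x =
      (\<Sum>i\<in>I. hypoexp_weight I \<alpha> i * (\<alpha> i / (\<alpha> i - \<alpha> m)) * exponential_density (\<alpha> m) x
        + hypoexp_weight I \<alpha> i * (\<alpha> m / (\<alpha> m - \<alpha> i)) * exponential_density (\<alpha> i) x)"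
    using assms(1,3) hypoexp_weight_insert_new[OF assms(1-5)]
    by (simp add: hypoexp_density_def hypoexp_weight_insert_old sum.distrib sum_distrib_right)
  also have "\<dots> = (\<Sum>i\<in>I. hypoexp_weight I \<alpha> i * \<alpha> i * \<alpha> m *
      ((exp (- \<alpha> m * x) - exp (- \<alpha> i * x)) / (\<alpha> i - \<alpha> m)))"
  proof (rule sum.cong[OF refl])
    fix i assume "i \<in> I"
    have *: "w * (a / (a - b)) * (b * u) + w * (b / (b - a)) * (a * v) =
        w * a * b * ((u - v) / (a - b))" if "a \<noteq> b" for a b u v w :: real
      using that by (simp add: divide_simps) (simp add: algebra_simps)
    show "hypoexp_weight I \<alpha> i * (\<alpha> i / (\<alpha> i - \<alpha> m)) * exponential_density (\<alpha> m) x
        + hypoexp_weight I \<alpha> i * (\<alpha> m / (\<alpha> m - \<alpha> i)) * exponential_density (\<alpha> i) x =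
      hypoexp_weight I \<alpha> i * \<alpha> i * \<alpha> m * ((exp (- \<alpha> m * x) - exp (- \<alpha> i * x)) / (\<alpha> i - \<alpha> m))"
      using *[OF ne[OF \<open>i \<in> I\<close>]] \<open>0 \<le> x\<close>
      by (simp only: exponential_density_def not_less[symmetric] if_False mult_minus_left
          mult.commute[of x])
  qed
  finally show ?thesis .
qed

lemma borel_measurable_hypoexp_density [measurable]:
  "hypoexp_density I \<alpha> \<in> borel_measurable borel"
  unfolding hypoexp_density_def[abs_def] by measurable

text \<open>The integrand has an explicit antiderivative on \<open>[0, x]\<close> whose increment is
  the enlarged density. Nonnegativity is carried along because the weights can have either sign: it
  passes from the old density to the new one as the increment of a nondecreasing function.\<close>

lemma hypoexp_density_convolution:
  assumes "finite I" "I \<noteq> {}" "m \<notin> I" "inj_on \<alpha> (insert m I)"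
    and pos: "\<And>i. i \<in> insert m I \<Longrightarrow> 0 < \<alpha> i"
    and nonneg: "\<And>x. 0 \<le> hypoexp_density I \<alpha> x"
  shows "(\<integral>\<^sup>+y. ennreal (exponential_density (\<alpha> m) (x - y)) * ennreal (hypoexp_density I \<alpha> y) \<partial>lborel)
      = ennreal (hypoexp_density (insert m I) \<alpha> x)" (is "?conv = ?R")
    and "0 \<le> hypoexp_density (insert m I) \<alpha> x" (is ?nonneg)
proof -
  have ne: "\<alpha> i \<noteq> \<alpha> m" if "i \<in> I" for i
    using that assms(3,4) by (auto simp: inj_on_def)
  let ?f = "\<lambda>y. exponential_density (\<alpha> m) (x - y) * hypoexp_density I \<alpha> y"
  \<comment> \<open>Termwise antiderivative of
    \<open>exp (- \<alpha> m * (x - y)) * exp (- \<alpha> i * y)\<close> in \<open>y\<close>; the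
    divisor is nonzero because the rates differ.\<close>
  let ?F = "\<lambda>y. \<Sum>i\<in>I. hypoexp_weight I \<alpha> i * \<alpha> i * \<alpha> m *
      (- exp (- \<alpha> m * x - (\<alpha> i - \<alpha> m) * y) / (\<alpha> i - \<alpha> m))"
  have f_nonneg: "0 \<le> ?f y" for y
    using nonneg pos by (simp add: less_imp_le)
  have "?conv = ?R \<and> ?nonneg"
  proof (cases "0 \<le> x")
    case True
    have deriv: "(?F has_real_derivative ?f y) (at y)" if "0 \<le> y" "y \<le> x" for y
    proof -
      have "(?F has_real_derivative (\<Sum>i\<in>I. hypoexp_weight I \<alpha> i * \<alpha> i * \<alpha> m *
          exp (- \<alpha> m * x - (\<alpha> i - \<alpha> m) * y))) (at y)"
      proof (rule DERIV_sum)
        fix i assume "i \<in> I"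
        have "((\<lambda>y. - exp (- \<alpha> m * x - d * y) / d) has_real_derivative exp (- \<alpha> m * x - d * y)) (at y)"
          if "d \<noteq> 0" for d
          using that by (auto intro!: derivative_eq_intros)
        from DERIV_cmult[OF this, of "\<alpha> i - \<alpha> m"]
        show "((\<lambda>y. hypoexp_weight I \<alpha> i * \<alpha> i * \<alpha> m *
            (- exp (- \<alpha> m * x - (\<alpha> i - \<alpha> m) * y) / (\<alpha> i - \<alpha> m))) has_real_derivative
            hypoexp_weight I \<alpha> i * \<alpha> i * \<alpha> m * exp (- \<alpha> m * x - (\<alpha> i - \<alpha> m) * y)) (at y)"
          using ne[OF \<open>i \<in> I\<close>] by simp
      qed
      also have "(\<Sum>i\<in>I. hypoexp_weight I \<alpha> i * \<alpha> i * \<alpha> m *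
          exp (- \<alpha> m * x - (\<alpha> i - \<alpha> m) * y)) = ?f y"
        using that unfolding hypoexp_density_def sum_distrib_left
        by (intro sum.cong) (auto simp: exponential_density_def algebra_simps simp flip: exp_add)
      finally show ?thesis .
    qed
    have FF: "?F x - ?F 0 = hypoexp_density (insert m I) \<alpha> x"
    proof -
      have "hypoexp_density (insert m I) \<alpha> x = (\<Sum>i\<in>I. hypoexp_weight I \<alpha> i * \<alpha> i * \<alpha> m *
          ((exp (- \<alpha> m * x) - exp (- \<alpha> i * x)) / (\<alpha> i - \<alpha> m)))"
      proof (rule hypoexp_density_insert[OF assms(1-4) _ True])
        show "\<alpha> i \<noteq> 0" if "i \<in> I" for i
          using pos[of i] that by simp
      qed
      also have "\<dots> = ?F x - ?F 0"
      proof -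
        have "- \<alpha> m * x - (\<alpha> i - \<alpha> m) * x = - \<alpha> i * x" for i
          by (simp add: algebra_simps)
        then show ?thesis
          by (simp add: diff_divide_distrib right_diff_distrib flip: sum_subtractf)
      qed
      finally show ?thesis ..
    qed
    \<comment> \<open>An exponential density vanishes at negative arguments, so only
      \<open>0 \<le> y \<le> x\<close> contributes.\<close>
    have "?conv = (\<integral>\<^sup>+y. ennreal (?f y) * indicator {0..x} y \<partial>lborel)"
      using pos nonneg
      by (intro nn_integral_cong)
        (auto simp: ennreal_mult hypoexp_density_def exponential_density_def less_imp_le
          split: split_indicator)
    also have "\<dots> = ennreal (?F x - ?F 0)"
      by (rule nn_integral_FTC_Icc[OF _ deriv f_nonneg True]) measurable
    finally have "?conv = ?R"
      unfolding FF .
    \<comment> \<open>The \<open>ennreal\<close> identity cannot give the sign, since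
      \<open>ennreal\<close> sends negative reals to 0; the sign of the derivative does.\<close>
    moreover have "?F 0 \<le> ?F x"
    proof (rule DERIV_nonneg_imp_nondecreasing[OF True])
      show "\<exists>D. (?F has_real_derivative D) (at y) \<and> 0 \<le> D" if "0 \<le> y" "y \<le> x" for y
        using deriv[OF that] f_nonneg[of y] by blast
    qed
    ultimately show ?thesis
      using FF by linarith
  next
    case False
    \<comment> \<open>For \<open>x < 0\<close>, one of \<open>y\<close> and \<open>x - y\<close> is
      negative.\<close>
    then have "?f y = 0" for y
      by (auto simp: hypoexp_density_def exponential_density_def)
    then have "ennreal (exponential_density (\<alpha> m) (x - y)) * ennreal (hypoexp_density I \<alpha> y) = 0" for y
      using pos nonneg by (simp add: less_imp_le flip: ennreal_mult)
    then have "?conv = 0"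
      by (simp only: nn_integral_const) simp
    then show ?thesis
      using False by (simp add: hypoexp_density_def exponential_density_def)
  qed
  then show "?conv = ?R" ?nonneg
    by auto
qed

lemma hypoexp_density_singleton:
  "hypoexp_density {i} \<alpha> = exponential_density (\<alpha> i)"
  by (simp add: fun_eq_iff hypoexp_density_def hypoexp_weight_def)

lemma hypoexp_density_nonneg:
  assumes "finite I" "I \<noteq> {}" "inj_on \<alpha> I" "\<And>i. i \<in> I \<Longrightarrow> 0 < \<alpha> i"
  shows "0 \<le> hypoexp_density I \<alpha> x"
  using assms
proof (induction I arbitrary: x rule: finite_ne_induct)
  case (singleton i)
  then show ?case
    by (simp add: hypoexp_density_singleton less_imp_le)
next
  case (insert m I)
  then show ?case
    by (intro hypoexp_density_convolution(2)) auto
qed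

text \<open>Induction over the summands: \<open>X m\<close> is independent of the sum of the others,
  so inserting it convolves the densities.\<close>

theorem (in prob_space) distributed_sum_hypoexp:
  assumes "finite I" "I \<noteq> {}" "inj_on \<alpha> I" "\<And>i. i \<in> I \<Longrightarrow> 0 < \<alpha> i"
    and "indep_vars (\<lambda>_. borel) X I"
    and "\<And>i. i \<in> I \<Longrightarrow> distributed M lborel (X i) (\<lambda>x. ennreal (exponential_density (\<alpha> i) x))"
  shows "distributed M lborel (\<lambda>\<omega>. \<Sum>i\<in>I. X i \<omega>) (\<lambda>x. ennreal (hypoexp_density I \<alpha> x))"
  using assms
proof (induction I rule: finite_ne_induct)
  case (singleton i)
  then show ?case
    by (simp add: hypoexp_density_singleton)
next
  case (insert m I)
  have "distributed M lborel (\<lambda>\<omega>. \<Sum>i\<in>I. X i \<omega>) (\<lambda>x. ennreal (hypoexp_density I \<alpha> x))"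
    using insert.prems by (intro insert.IH) (auto intro: indep_vars_subset)
  moreover have "indep_var borel (X m) borel (\<lambda>\<omega>. \<Sum>i\<in>I. X i \<omega>)"
    using insert by (intro indep_vars_sum) auto
  ultimately have "distributed M lborel (\<lambda>\<omega>. X m \<omega> + (\<Sum>i\<in>I. X i \<omega>))
      (\<lambda>x. \<integral>\<^sup>+y. ennreal (exponential_density (\<alpha> m) (x - y)) * ennreal (hypoexp_density I \<alpha> y) \<partial>lborel)"
    using insert.prems by (intro distributed_convolution) auto
  moreover have "(\<integral>\<^sup>+y. ennreal (exponential_density (\<alpha> m) (x - y)) * ennreal (hypoexp_density I \<alpha> y) \<partial>lborel)
      = ennreal (hypoexp_density (insert m I) \<alpha> x)" for x
    using insert by (intro hypoexp_density_convolution(1) hypoexp_density_nonneg) auto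
  ultimately show ?case
    using insert.hyps by simp
qed

section \<open>Linear independence of exponentials\<close>

text \<open>If the property failed from some \<open>N\<close> on, the interval
  \<open>{N..N + 1}\<close> would be a null set. This lets almost-everywhere identities be compared
  with limits at infinity.\<close>

lemma AE_lborel_imp_frequently_at_top:
  assumes "AE x::real in lborel. P x"
  shows "\<exists>\<^sub>F x in at_top. P x"
proof (rule ccontr)
  assume "\<not> (\<exists>\<^sub>F x in at_top. P x)"
  then obtain N where N: "\<And>x. N \<le> x \<Longrightarrow> \<not> P x"
    by (auto simp: not_frequently eventually_at_top_linorder)
  have "AE x in lborel. x \<notin> {N..N + 1}"
    using assms by eventually_elim (auto dest: N)
  then have "{N..N + 1} \<in> null_sets lborel"
    by (subst AE_iff_null_sets) auto
  then show False
    by (simp add: null_sets_def)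
qed

text \<open>The term of smallest rate dominates. Among the terms with nonzero coefficient let
  \<open>\<alpha> m\<close> be the least rate; multiplied by \<open>exp (t * \<alpha> m)\<close>,
  the sum tends to \<open>B m \<noteq> 0\<close>, yet it vanishes at arbitrarily large
  \<open>t\<close>.\<close>

lemma exponential_combination_AE_zero:
  fixes B \<alpha> :: "'i \<Rightarrow> real"
  assumes "finite I" "inj_on \<alpha> I"
    and "AE t in lborel. 0 \<le> t \<longrightarrow> (\<Sum>i\<in>I. B i * exp (- t * \<alpha> i)) = 0"
    and "i \<in> I"
  shows "B i = 0"
proof (rule ccontr)
  assume "B i \<noteq> 0"
  define J where "J = {j \<in> I. B j \<noteq> 0}"
  have J: "finite J" "J \<noteq> {}" "J \<subseteq> I"
    using assms \<open>B i \<noteq> 0\<close> by (auto simp: J_def)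
  obtain m where m: "m \<in> J" "\<And>j. j \<in> J \<Longrightarrow> \<alpha> m \<le> \<alpha> j"
    using ex_min_if_finite[of "\<alpha> ` J"] J by (auto simp: not_less)
  let ?g = "\<lambda>t. \<Sum>j\<in>J. B j * exp (- t * (\<alpha> j - \<alpha> m))"
  have "((\<lambda>t. B j * exp (- t * (\<alpha> j - \<alpha> m))) \<longlongrightarrow> (if j = m then B m else 0)) at_top" if "j \<in> J" for j
  proof (cases "j = m")
    case False
    then have "0 < \<alpha> j - \<alpha> m"
      using that m J assms(2) by (metis diff_gt_0_iff_gt inj_onD order_le_imp_less_or_eq subsetD)
    then have "((\<lambda>t. B j * exp (- t * (\<alpha> j - \<alpha> m))) \<longlongrightarrow> 0) at_top"
      by real_asymp
    then show ?thesis
      using False by simp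
  qed simp
  then have "(?g \<longlongrightarrow> (\<Sum>j\<in>J. if j = m then B m else 0)) at_top"
    by (rule tendsto_sum)
  then have "(?g \<longlongrightarrow> B m) at_top"
    using m J by simp
  then have "\<forall>\<^sub>F t in at_top. ?g t \<noteq> 0"
    using m by (intro tendsto_imp_eventually_ne) (auto simp: J_def)
  moreover have "\<exists>\<^sub>F t in at_top. 0 \<le> t \<longrightarrow> (\<Sum>i\<in>I. B i * exp (- t * \<alpha> i)) = 0"
    by (rule AE_lborel_imp_frequently_at_top) fact
  ultimately have "\<exists>\<^sub>F t in at_top. (?g t \<noteq> 0 \<and> 0 \<le> t) \<and> (0 \<le> t \<longrightarrow> (\<Sum>i\<in>I. B i * exp (- t * \<alpha> i)) = 0)"
    using eventually_ge_at_top[of "0::real"]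
    by (intro frequently_eventually_conj eventually_conj)
  then obtain t where t: "?g t \<noteq> 0" "(\<Sum>i\<in>I. B i * exp (- t * \<alpha> i)) = 0"
    using frequently_ex by blast
  have "?g t = exp (t * \<alpha> m) * (\<Sum>j\<in>J. B j * exp (- t * \<alpha> j))"
    by (simp add: sum_distrib_left algebra_simps flip: exp_add)
  also have "(\<Sum>j\<in>J. B j * exp (- t * \<alpha> j)) = (\<Sum>i\<in>I. B i * exp (- t * \<alpha> i))"
    using assms(1) by (intro sum.mono_neutral_left) (auto simp: J_def)
  finally show False
    using t by simp
qed

lemma exponential_density_combination_unique:
  fixes A B \<alpha> :: "'i \<Rightarrow> real"
  assumes "finite I" "inj_on \<alpha> I" "\<And>i. i \<in> I \<Longrightarrow> \<alpha> i \<noteq> 0"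
    and "AE t in lborel. (\<Sum>i\<in>I. A i * exponential_density (\<alpha> i) t) =
      (\<Sum>i\<in>I. B i * exponential_density (\<alpha> i) t)"
    and "i \<in> I"
  shows "A i = B i"
proof -
  \<comment> \<open>On negative \<open>t\<close> all densities are 0, so only
    \<open>t \<ge> 0\<close> carries information. The factor \<open>\<alpha> i\<close> of the
    density goes into the coefficient and is cancelled at the end because it is nonzero.\<close>
  have "AE t in lborel. 0 \<le> t \<longrightarrow> (\<Sum>i\<in>I. ((A i - B i) * \<alpha> i) * exp (- t * \<alpha> i)) = 0"
    using assms(4)
    by eventually_elim (auto simp: exponential_density_def algebra_simps sum_subtractf)
  from exponential_combination_AE_zero[OF assms(1,2) this assms(5)] show ?thesis
    using assms(3,5) by simp
qed

section \<open>The extreme value distribution\<close>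

text \<open>Change of variables: \<open>exp (t / c)\<close> inverts \<open>c * ln x\<close> on the
  positive reals, and \<open>exp (t / c) / (- c)\<close> is the absolute value of its
  derivative.\<close>

lemma extreme_value_density_eq:
  assumes "c < 0" "a > 0"
  shows "extreme_value_density (- c * ln a) (- c) t =
    exponential_density a (exp (t / c)) * (exp (t / c) / (- c))"
proof -
  have "(- t + - c * ln a) / (- c) = t / c + ln a"
    using assms by (simp add: field_simps)
  moreover have "exp (t / c + ln a) = exp (t / c) * a"
    using assms by (simp add: exp_add)
  ultimately show ?thesis
    unfolding extreme_value_density_def exponential_density_def exp_add[of "- exp _"] by simp
qed

lemma borel_measurable_extreme_value_density [measurable]:
  "extreme_value_density k l \<in> borel_measurable borel"
  unfolding extreme_value_density_def[abs_def] by measurable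

lemma extreme_value_density_nonneg:
  "0 < l \<Longrightarrow> 0 \<le> extreme_value_density k l t"
  by (simp add: extreme_value_density_def)

text \<open>Both measures are compared on the half-lines \<open>{t<..}\<close>, which determine
  them. As \<open>c < 0\<close>, the map \<open>c * ln x\<close> is decreasing, so an upper tail of
  the image is a lower tail of \<open>X\<close>.\<close>

lemma (in prob_space) distributed_ln_exponential:
  assumes X: "distributed M lborel X (\<lambda>x. ennreal (exponential_density a x))"
    and "c < 0" "0 < a"
  shows "distributed M lborel (\<lambda>\<omega>. c * ln (X \<omega>))
    (\<lambda>t. ennreal (extreme_value_density (- c * ln a) (- c) t))"
proof -
  let ?e = "extreme_value_density (- c * ln a) (- c)"
  have [measurable]: "X \<in> borel_measurable M"
    using distributed_measurable[OF X] by simp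
  have tail_X: "emeasure (distr M lborel (\<lambda>\<omega>. c * ln (X \<omega>))) {t<..} =
      ennreal (1 - exp (- a * exp (t / c)))" for t
  proof -
    \<comment> \<open>Positivity makes \<open>ln\<close> the inverse of \<open>exp\<close>;
      excluding the null event \<open>X = exp (t / c)\<close> turns the strict inequality into the
      \<open>\<le>\<close> of the distribution function.\<close>
    have "AE \<omega> in M. X \<omega> > 0 \<and> X \<omega> \<noteq> exp (t / c)"
    proof (subst distributed_AE2[OF X])
      show "AE x in lborel. 0 < ennreal (exponential_density a x) \<longrightarrow> 0 < x \<and> x \<noteq> exp (t / c)"
        using AE_lborel_singleton[of "0::real"] AE_lborel_singleton[of "exp (t / c)"]
        by eventually_elim (auto simp: exponential_density_def)
    qed simp
    then have "AE \<omega> in M. t < c * ln (X \<omega>) \<longleftrightarrow> X \<omega> \<le> exp (t / c)"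
    proof eventually_elim
      case (elim \<omega>)
      have "t < c * ln (X \<omega>) \<longleftrightarrow> ln (X \<omega>) < t / c"
        using \<open>c < 0\<close> by (simp add: field_simps)
      also have "\<dots> \<longleftrightarrow> X \<omega> < exp (t / c)"
        using elim by (metis exp_less_cancel_iff exp_ln)
      finally show ?case
        using elim by auto
    qed
    then have "emeasure M {\<omega> \<in> space M. t < c * ln (X \<omega>)} =
        emeasure M {\<omega> \<in> space M. X \<omega> \<le> exp (t / c)}"
      by (intro emeasure_eq_AE) auto
    also have "\<dots> = ennreal (1 - exp (- a * exp (t / c)))"
      using exponential_distributedD_le[OF X, of "exp (t / c)"] \<open>0 < a\<close>
      by (simp add: emeasure_eq_measure mult.commute)
    finally show ?thesis
      by (simp add: emeasure_distr vimage_def Int_def conj_commute)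
  qed
  have tail_e: "emeasure (density lborel (\<lambda>t. ennreal (?e t))) {t<..} =
      ennreal (1 - exp (- a * exp (t / c)))" for t
  proof -
    have "emeasure (density lborel (\<lambda>t. ennreal (?e t))) {t<..} =
        (\<integral>\<^sup>+x. ennreal (?e x) * indicator {t<..} x \<partial>lborel)"
      by (rule emeasure_density) auto
    also have "\<dots> = (\<integral>\<^sup>+x. ennreal (?e x) * indicator {t..} x \<partial>lborel)"
      using AE_lborel_singleton[of t]
      by (intro nn_integral_cong_AE, eventually_elim) (auto split: split_indicator)
    \<comment> \<open>The antiderivative is \<open>exp (- a * exp (x / c))\<close>; its limit at
      infinity is \<open>exp (- a * 0)\<close>, since \<open>x / c\<close> tends to minus infinity
      for \<open>c < 0\<close>.\<close>
    also have "\<dots> = ennreal (exp (- a * 0) - exp (- a * exp (t / c)))"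
    proof (rule nn_integral_FTC_atLeast)
      show "((\<lambda>x. exp (- a * exp (x / c))) has_real_derivative ?e x) (at x)" for x
        using assms unfolding extreme_value_density_eq[OF assms(2,3)]
        by (auto intro!: derivative_eq_intros simp: exponential_density_def field_simps)
      have "filterlim (\<lambda>x. x / c) at_bot at_top"
        using \<open>c < 0\<close> by real_asymp
      then show "((\<lambda>x. exp (- a * exp (x / c))) \<longlongrightarrow> exp (- a * 0)) at_top"
        by (intro tendsto_intros filterlim_compose[OF exp_at_bot])
    qed (use \<open>c < 0\<close> in \<open>auto intro: extreme_value_density_nonneg\<close>)
    finally show ?thesis
      by simp
  qed
  have "distr M lborel (\<lambda>\<omega>. c * ln (X \<omega>)) = density lborel (\<lambda>t. ennreal (?e t))"
    by (rule measure_eqI_lessThan) (simp_all only: tail_X tail_e, auto)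
  then show ?thesis
    by (simp add: distributed_def)
qed

section \<open>The mixed distribution\<close>

text \<open>\<open>mixed_TG\<close> is a relation, so unique existence is claimed as well: it keeps
  the statement about every such \<open>D\<close> from being vacuous. The domain
  \<open>{0<..}\<close> is where \<open>c * ln x\<close> is one-to-one.\<close>

theorem theorem14:
  fixes M :: "'a measure" and X Y :: "nat \<Rightarrow> 'a \<Rightarrow> real"
    and n :: nat and \<alpha> k :: "nat \<Rightarrow> real" and c l :: real
  assumes "prob_space M"
    and "n \<ge> 2"
    and "\<And>i. i \<in> {1..n} \<Longrightarrow> \<alpha> i > 0"
    and "inj_on \<alpha> {1..n}"
    and "c < 0"
    and "prob_space.indep_vars M (\<lambda>_. borel) X {1..n}"
    and "\<And>i. i \<in> {1..n} \<Longrightarrow> distributed M lborel (X i) (\<lambda>x. ennreal (exponential_density (\<alpha> i) x))"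
    and "\<And>i. i \<in> {1..n} \<Longrightarrow> k i = - c * ln (\<alpha> i)"
    and "l = - c"
    and "\<And>i \<omega>. i \<in> {1..n} \<Longrightarrow> Y i \<omega> = c * ln (X i \<omega>)"
  shows "(\<forall>i\<in>{1..n}. distributed M lborel (Y i) (\<lambda>t. ennreal (extreme_value_density (k i) l t)))
    \<and> (\<exists>!D. mixed_TG {1..n} (\<lambda>i. distr M borel (X i)) (distr M borel (\<lambda>\<omega>. \<Sum>i=1..n. X i \<omega>))
               {0<..} (\<lambda>x. c * ln x) D)
    \<and> (\<forall>D. mixed_TG {1..n} (\<lambda>i. distr M borel (X i)) (distr M borel (\<lambda>\<omega>. \<Sum>i=1..n. X i \<omega>))
               {0<..} (\<lambda>x. c * ln x) D
           \<longrightarrow> has_pdf D (\<lambda>t. \<Sum>i=1..n. 1 / PE n k l i * extreme_value_density (k i) l t))"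
proof -
  interpret prob_space M by fact
  note pos = assms(3) and dist = assms(7)
  let ?I = "{1..n}" and ?g = "\<lambda>x. c * ln x"
  let ?w = "hypoexp_weight ?I \<alpha>"
  let ?e = "\<lambda>i. extreme_value_density (k i) l"
  let ?h = "\<lambda>t. \<Sum>i=1..n. 1 / PE n k l i * ?e i t"
  let ?T = "distr M borel (\<lambda>\<omega>. \<Sum>i=1..n. X i \<omega>)"
  let ?D = "density lborel (\<lambda>t. ennreal (?h t))"
  have I: "finite ?I" "?I \<noteq> {}"
    using assms(2) by auto
  have X [measurable]: "X i \<in> borel_measurable M" if "i \<in> ?I" for i
    using distributed_measurable[OF dist[OF that]] by simp

  \<comment> \<open>By the choice of \<open>k\<close> and \<open>l\<close>,
    \<open>exp ((k i - k j) / l)\<close> is \<open>\<alpha> i / \<alpha> j\<close>, so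
    \<open>PE\<close> is the hypoexponential \<open>P_i\<close>.\<close>
  have weight: "1 / PE n k l i = ?w i" if "i \<in> ?I" for i
  proof -
    have "1 / (1 - exp ((k i - k j) / l)) = \<alpha> j / (\<alpha> j - \<alpha> i)" if "j \<in> ?I - {i}" for j
    proof -
      have "(k i - k j) / l = ln (\<alpha> i) - ln (\<alpha> j)"
        using that \<open>i \<in> ?I\<close> assms(5,8,9) by (simp add: field_simps)
      then have "exp ((k i - k j) / l) = \<alpha> i / \<alpha> j"
        using that \<open>i \<in> ?I\<close> pos by (simp add: exp_diff)
      moreover have "\<alpha> j \<noteq> 0"
        using that pos[of j] by auto
      ultimately show ?thesis
        by (simp add: diff_divide_eq_iff)
    qed
    then show ?thesis
      unfolding PE_def hypoexp_weight_def
      by (simp add: prod_dividef[symmetric, where f = "\<lambda>_. 1", simplified])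
  qed

  have Y: "distributed M lborel (\<lambda>\<omega>. c * ln (X i \<omega>)) (\<lambda>t. ennreal (?e i t))" if "i \<in> ?I" for i
    using distributed_ln_exponential[OF dist[OF that] \<open>c < 0\<close> pos[OF that]] assms(8)[OF that] assms(9)
    by simp
  have pdf_X: "has_pdf (distr M borel (X i)) (exponential_density (\<alpha> i))" if "i \<in> ?I" for i
    using that dist pos by (intro has_pdf_distr) (auto simp: less_imp_le)
  have pdf_gX: "has_pdf (distr (distr M borel (X i)) borel ?g) (?e i)" if "i \<in> ?I" for i
  proof -
    have "has_pdf (distr M borel (\<lambda>\<omega>. c * ln (X i \<omega>))) (?e i)"
      using that Y assms(5,9) by (intro has_pdf_distr) (auto intro: extreme_value_density_nonneg)
    then show ?thesis
      using that by (subst distr_distr) (auto simp: o_def)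
  qed
  have pdf_T: "has_pdf ?T (\<lambda>t. \<Sum>i=1..n. ?w i * exponential_density (\<alpha> i) t)"
    using has_pdf_distr[OF distributed_sum_hypoexp[OF I assms(4) pos assms(6) dist]]
      hypoexp_density_nonneg[OF I assms(4) pos]
    by (simp add: hypoexp_density_def[abs_def])

  \<comment> \<open>Termwise signs do not help, but by change of variables \<open>?h t\<close> is
    the hypoexponential density at \<open>exp (t / c)\<close> times a positive Jacobian.\<close>
  have h_nonneg: "0 \<le> ?h t" for t
  proof -
    have "?h t = (\<Sum>i=1..n. ?w i * (exponential_density (\<alpha> i) (exp (t / c)) * (exp (t / c) / (- c))))"
      using weight pos assms(5,8,9) extreme_value_density_eq by (intro sum.cong) auto
    also have "\<dots> = hypoexp_density ?I \<alpha> (exp (t / c)) * (exp (t / c) / (- c))"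
      unfolding hypoexp_density_def sum_distrib_right by (simp add: mult.assoc)
    also have "\<dots> \<ge> 0"
      using hypoexp_density_nonneg[OF I assms(4) pos] \<open>c < 0\<close>
      by (intro mult_nonneg_nonneg divide_nonneg_pos) auto
    finally show ?thesis .
  qed
  \<comment> \<open>Bochner integrals are used because weights may be negative, where nonnegative
    integrals are not linear. The total mass of \<open>?h\<close> is then the sum of the weights,
    which is 1.\<close>
  have e_int: "has_bochner_integral lborel (?e i) 1" if "i \<in> ?I" for i
  proof -
    have "prob_space (density lborel (\<lambda>t. ennreal (?e i t)))"
      using pdf_gX[OF that] by (auto simp: has_pdf_def)
    then have "(\<integral>\<^sup>+t. ennreal (?e i t) \<partial>lborel) = ennreal 1"
      using prob_space.emeasure_space_1 by (force simp: emeasure_density)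
    then show ?thesis
      using assms(5,9) by (intro has_bochner_integral_nn_integral)
        (auto intro!: AE_I2 extreme_value_density_nonneg)
  qed
  have "has_bochner_integral lborel ?h (\<Sum>i=1..n. 1 / PE n k l i * 1)"
    by (intro has_bochner_integral_sum has_bochner_integral_mult_right e_int) auto
  also have "(\<Sum>i=1..n. 1 / PE n k l i * 1) = 1"
    using sum_hypoexp_weight[OF I assms(4)] weight by simp
  finally have "(\<integral>\<^sup>+t. ennreal (?h t) \<partial>lborel) = 1"
    using h_nonneg nn_integral_eq_integral[of lborel ?h]
    by (auto simp: has_bochner_integral_iff)
  then have pdf_D: "has_pdf ?D ?h"
    unfolding has_pdf_def using h_nonneg
    by (auto intro!: prob_spaceI simp: emeasure_density)

  have X_pos: "AE x in distr M borel (X i). x \<in> {0<..}" if "i \<in> ?I" for i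
  proof -
    have "distr M borel (X i) = density lborel (\<lambda>x. ennreal (exponential_density (\<alpha> i) x))"
      using pdf_X[OF that] by (simp add: has_pdf_def)
    \<comment> \<open>\<open>exponential_density\<close> is positive at 0 too, so that single point
      is discarded as a null set.\<close>
    moreover have "AE x in lborel. 0 < ennreal (exponential_density (\<alpha> i) x) \<longrightarrow> x \<in> {0<..}"
      using AE_lborel_singleton[of "0::real"]
      by eventually_elim (auto simp: exponential_density_def)
    ultimately show ?thesis
      by (simp only:) (subst AE_density, auto)
  qed
  have inj: "inj_on ?g {0<..}"
    using \<open>c < 0\<close> by (auto simp: inj_on_def)
  have pdf_D': "has_pdf ?D (\<lambda>t. \<Sum>i=1..n. ?w i * ?e i t)"
  proof -
    have "?h = (\<lambda>t. \<Sum>i=1..n. ?w i * ?e i t)"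
      by (intro ext sum.cong refl) (simp only: weight)
    with pdf_D show ?thesis
      by simp
  qed
  have mixed_D: "mixed_TG ?I (\<lambda>i. distr M borel (X i)) ?T {0<..} ?g ?D"
    unfolding mixed_TG_def
  proof (intro conjI)
    show "\<exists>A fX fgX. (\<Sum>i\<in>?I. A i) = 1 \<and> (\<forall>i\<in>?I. has_pdf (distr M borel (X i)) (fX i)) \<and>
        has_pdf ?T (\<lambda>t. \<Sum>i\<in>?I. A i * fX i t) \<and>
        (\<forall>i\<in>?I. has_pdf (distr (distr M borel (X i)) borel ?g) (fgX i)) \<and>
        has_pdf ?D (\<lambda>t. \<Sum>i\<in>?I. A i * fgX i t)"
      by (rule exI[of _ ?w], rule exI[of _ "\<lambda>i. exponential_density (\<alpha> i)"], rule exI[of _ ?e])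
        (intro conjI ballI sum_hypoexp_weight I assms(4) pdf_X pdf_T pdf_gX pdf_D')
  qed (use X_pos inj in auto)

  have mixed_unique: "D = ?D" if mixed: "mixed_TG ?I (\<lambda>i. distr M borel (X i)) ?T {0<..} ?g D" for D
  proof -
    obtain A fX fgX where
      fX: "\<And>i. i \<in> ?I \<Longrightarrow> has_pdf (distr M borel (X i)) (fX i)"
      and T: "has_pdf ?T (\<lambda>t. \<Sum>i=1..n. A i * fX i t)"
      and fgX: "\<And>i. i \<in> ?I \<Longrightarrow> has_pdf (distr (distr M borel (X i)) borel ?g) (fgX i)"
      and D: "has_pdf D (\<lambda>t. \<Sum>i=1..n. A i * fgX i t)"
      using mixed unfolding mixed_TG_def by blast
    \<comment> \<open>Finitely many indices leave a single null set outside which all chosen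
      versions are the standard ones. The two densities of \<open>?T\<close> then agree almost
      everywhere, and linear independence forces the weights.\<close>
    have "AE t in lborel. \<forall>i\<in>?I. fX i t = exponential_density (\<alpha> i) t"
      using fX pdf_X by (intro AE_finite_allI has_pdf_AE_unique) auto
    with has_pdf_AE_unique[OF T pdf_T]
    have "AE t in lborel. (\<Sum>i=1..n. A i * exponential_density (\<alpha> i) t) =
        (\<Sum>i=1..n. ?w i * exponential_density (\<alpha> i) t)"
      by eventually_elim simp
    then have A: "A i = ?w i" if "i \<in> ?I" for i
      using that pos I assms(4) exponential_density_combination_unique[of ?I \<alpha> A ?w i] by force
    have "AE t in lborel. \<forall>i\<in>?I. fgX i t = ?e i t"
      using fgX pdf_gX by (intro AE_finite_allI has_pdf_AE_unique) auto
    then have "AE t in lborel. (\<Sum>i=1..n. A i * fgX i t) = ?h t"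
      by eventually_elim (intro sum.cong, auto simp: A weight)
    then have "density lborel (\<lambda>t. ennreal (\<Sum>i=1..n. A i * fgX i t)) = ?D"
      using D pdf_D by (intro density_cong) (auto simp: has_pdf_def)
    then show ?thesis
      using D by (simp add: has_pdf_def)
  qed

  have "distributed M lborel (Y i) (\<lambda>t. ennreal (?e i t))" if "i \<in> ?I" for i
  proof -
    have "Y i = (\<lambda>\<omega>. c * ln (X i \<omega>))"
      using assms(10)[OF that] by auto
    then show ?thesis
      using Y[OF that] by simp
  qed
  then show ?thesis
    using mixed_D mixed_unique pdf_D by blast
qed

end
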